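(* Let $(X,\kappa)$ and $(Y,\lambda)$ be digital images, $x_0\in X$, $y_0\in Y$, and suppose $(X,x_0)$ and $(Y,y_0)$ have the same pointed real homotopy type, $(X,x_0)\simeq^{\mathbb R}_{\kappa,\lambda}(Y,y_0)$. Then the groups $\Pi_1^{\kappa}(X,x_0)$ and $\Pi_1^{\lambda}(Y,y_0)$ are isomorphic.
   Context: A digital image $(X,\kappa)$ is a set $X\subset\mathbb Z^n$ (for some $n\ge 1$) with an adjacency relation $\kappa$ (a symmetric, irreflexive relation). A subset is $\kappa$-connected if any two distinct points of it are joined by a finite sequence of points of the subset whose consecutive members are $\kappa$-adjacent. A function $f:(X,\kappa)\to(Y,\lambda)$ is $(\kappa,\lambda)$-continuous if it maps $\kappa$-connected sets to $\lambda$-connected sets; equivalently, $\kappa$-adjacent points are mapped to equal or $\lambda$-adjacent points. $\mathbb N=\{1,2,\dots\}$, $\mathbb N^*=\{0\}\cup\mathbb N$, $[a,b]_{\mathbb Z}=\{z\in\mathbb Z: a\le z\le b\}$; subsets of $\mathbb Z$ carry the adjacency in which consecutive integers are adjacent. Real path: $f:[0,1]\to (Y,\lambda)$ (with $[0,1]\subset\mathbb R$) is a real $\lambda$-path if (i) there is $\epsilon_0>0$ such that $f$ is constant on $(0,\epsilon_0)$ with value equal or $\lambda$-adjacent to $f(0)$; (ii) there is $\epsilon_1>0$ such that $f$ is constant on $(1-\epsilon_1,1)$ with value equal or $\lambda$-adjacent to $f(1)$; (iii) for each $t\in(0,1)$ there is $\epsilon_t>0$ such that $f$ is constant on each of $(t-\epsilon_t,t)$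 and $(t,t+\epsilon_t)$, these two constant values are equal or $\lambda$-adjacent, and at least one of them equals $f(t)$. Real homotopy: for continuous $f,g:(X,\kappa)\to(Y,\lambda)$, a real homotopy from $f$ to $g$ is $F:X\times[0,1]\to Y$ with $F(x,0)=f(x)$, $F(x,1)=g(x)$ for all $x$, such that $t\mapsto F(x,t)$ is a real $\lambda$-path in $Y$ for each $x\in X$, and $x\mapsto F(x,t)$ is $(\kappa,\lambda)$-continuous for each $t\in[0,1]$. Then $f\simeq^{\mathbb R}g$. It is pointed with respect to $x_0\in X$, $y_0\in Y$ if $F(x_0,t)=y_0$ for all $t\in[0,1]$. $(X,x_0)\simeq^{\mathbb R}_{\kappa,\lambda}(Y,y_0)$ (same pointed real homotopy type) means there are continuous $f:X\to Y$, $g:Y\to X$ with $f(x_0)=y_0$, $g(y_0)=x_0$, a real homotopy from $g\circ f$ to $1_X$ that is constantly $x_0$ at $x_0$, and a real homotopy from $f\circ g$ to $1_Y$ that is constantly $y_0$ at $y_0$. Homotopy (used for the fundamental group): continuous $f,g:(X,\kappa)\to(Y,\lambda)$ are homotopic if there are a positive integer $m$ and $F:X\times[0,m]_{\mathbb Z}\to Y$ with $F(x,0)=f(x)$, $F(x,m)=g(x)$, continuous in $t$ for each $x$ and in $x$ for each $t$. Fundamental group: an EC path in $X$ is a continuous $f:\mathbb N^*\to X$ that is eventually constant, with eventual value $f(\infty)$; it is an EC loop based at $f(0)$ if $f(0)=f(\infty)$. An EC homotopy between EC paths $f,g$ is a homotopy $H:[0,k]_{\mathbb Z}\times\mathbb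 N^*\to X$ ($[0,k]_{\mathbb Z}$ is the homotopy parameter) from $f$ to $g$ such that every $H_s(t)=H(s,t)$ is an EC path; it holds the endpoints fixed if $H_s(0)=f(0)=g(0)$ for all $s$ and there is $c\in\mathbb N$ with $H_s(n)=f(n)=g(n)$ for all $n\ge c$ and all $s$. For an EC loop $f$, $N_f=\min\{m\in\mathbb N^*: f(n)=f(m)\text{ for all }n\ge m\}$. For $x_0$-based EC loops, $(f_0*f_1)(n)=f_0(n)$ if $0\le n\le N_{f_0}$ and $f_1(n-N_{f_0})$ if $n\ge N_{f_0}$. $\Pi_1^\kappa(X,x_0)$ is the set of classes $[f]$ of $x_0$-based EC loops under EC homotopy holding the endpoints fixed, a group under $[f]\cdot[g]=[f*g]$. *)

theory Defs
  imports Complex_Main "HOL-Analysis.Finite_Cartesian_Product" "HOL-Algebra.Group"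
begin

section \<open>Digital images and continuity\<close>

definition digital_image :: "(int ^ 'n) set \<Rightarrow> (int ^ 'n \<Rightarrow> int ^ 'n \<Rightarrow> bool) \<Rightarrow> bool" where
  "digital_image X \<kappa> \<longleftrightarrow> symp_on X \<kappa> \<and> irreflp_on X \<kappa>"

definition adj_or_eq :: "('a \<Rightarrow> 'a \<Rightarrow> bool) \<Rightarrow> 'a \<Rightarrow> 'a \<Rightarrow> bool" where
  "adj_or_eq \<kappa> x y \<longleftrightarrow> x = y \<or> \<kappa> x y"

definition dig_connected :: "('a \<Rightarrow> 'a \<Rightarrow> bool) \<Rightarrow> 'a set \<Rightarrow> bool" where
  "dig_connected \<kappa> A \<longleftrightarrow>
     (\<forall>x\<in>A. \<forall>y\<in>A. x \<noteq> y \<longrightarrow>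
        (\<exists>p. p \<noteq> [] \<and> hd p = x \<and> last p = y \<and> set p \<subseteq> A \<and> successively \<kappa> p))"

definition dig_cont ::
    "'a set \<Rightarrow> ('a \<Rightarrow> 'a \<Rightarrow> bool) \<Rightarrow> 'b set \<Rightarrow> ('b \<Rightarrow> 'b \<Rightarrow> bool) \<Rightarrow> ('a \<Rightarrow> 'b) \<Rightarrow> bool" where
  "dig_cont X \<kappa> Y \<mu> f \<longleftrightarrow>
     f ` X \<subseteq> Y \<and> (\<forall>A\<subseteq>X. dig_connected \<kappa> A \<longrightarrow> dig_connected \<mu> (f ` A))"

text \<open>
  The type of natural numbers, which includes 0, serves as the non-negative integers; the integer
  interval from 0 to \<open>m\<close> is its subset \<open>{0..m}\<close>.
\<close>

definition consec :: "nat \<Rightarrow> nat \<Rightarrow> bool" where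
  "consec i j \<longleftrightarrow> j = Suc i \<or> i = Suc j"


section \<open>Real homotopy\<close>

text \<open>
  Only the values of \<open>f\<close> on \<open>{0..1}\<close> matter below: each \<open>\<epsilon>\<close> may be shrunk, so that the intervals on
  which \<open>f\<close> is required to be constant lie inside \<open>{0..1}\<close>.
\<close>

definition real_path :: "'b set \<Rightarrow> ('b \<Rightarrow> 'b \<Rightarrow> bool) \<Rightarrow> (real \<Rightarrow> 'b) \<Rightarrow> bool" where
  "real_path Y \<mu> f \<longleftrightarrow>
     f ` {0..1} \<subseteq> Y \<and>
     (\<exists>\<epsilon>>0. \<exists>a. (\<forall>s\<in>{0<..<\<epsilon>}. f s = a) \<and> adj_or_eq \<mu> a (f 0)) \<and>
     (\<exists>\<epsilon>>0. \<exists>b. (\<forall>s\<in>{1-\<epsilon><..<1}. f s = b) \<and> adj_or_eq \<mu> b (f 1)) \<and>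
     (\<forall>t\<in>{0<..<1}. \<exists>\<epsilon>>0. \<exists>a b.
        (\<forall>s\<in>{t-\<epsilon><..<t}. f s = a) \<and> (\<forall>s\<in>{t<..<t+\<epsilon>}. f s = b) \<and>
        adj_or_eq \<mu> a b \<and> (f t = a \<or> f t = b))"

definition real_homotopy ::
    "'a set \<Rightarrow> ('a \<Rightarrow> 'a \<Rightarrow> bool) \<Rightarrow> 'b set \<Rightarrow> ('b \<Rightarrow> 'b \<Rightarrow> bool) \<Rightarrow>
     ('a \<Rightarrow> 'b) \<Rightarrow> ('a \<Rightarrow> 'b) \<Rightarrow> ('a \<Rightarrow> real \<Rightarrow> 'b) \<Rightarrow> bool" where
  "real_homotopy X \<kappa> Y \<mu> f g F \<longleftrightarrow>
     dig_cont X \<kappa> Y \<mu> f \<and> dig_cont X \<kappa> Y \<mu> g \<and>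
     (\<forall>x\<in>X. F x 0 = f x \<and> F x 1 = g x) \<and>
     (\<forall>x\<in>X. real_path Y \<mu> (F x)) \<and>
     (\<forall>t\<in>{0..1}. dig_cont X \<kappa> Y \<mu> (\<lambda>x. F x t))"

definition pointed_real_homotopy ::
    "'a set \<Rightarrow> ('a \<Rightarrow> 'a \<Rightarrow> bool) \<Rightarrow> 'a \<Rightarrow> 'b set \<Rightarrow> ('b \<Rightarrow> 'b \<Rightarrow> bool) \<Rightarrow> 'b \<Rightarrow>
     ('a \<Rightarrow> 'b) \<Rightarrow> ('a \<Rightarrow> 'b) \<Rightarrow> ('a \<Rightarrow> real \<Rightarrow> 'b) \<Rightarrow> bool" where
  "pointed_real_homotopy X \<kappa> x0 Y \<mu> y0 f g F \<longleftrightarrow>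
     real_homotopy X \<kappa> Y \<mu> f g F \<and> (\<forall>t\<in>{0..1}. F x0 t = y0)"

definition same_pointed_real_homotopy_type ::
    "'a set \<Rightarrow> ('a \<Rightarrow> 'a \<Rightarrow> bool) \<Rightarrow> 'a \<Rightarrow> 'b set \<Rightarrow> ('b \<Rightarrow> 'b \<Rightarrow> bool) \<Rightarrow> 'b \<Rightarrow> bool" where
  "same_pointed_real_homotopy_type X \<kappa> x0 Y \<mu> y0 \<longleftrightarrow>
     (\<exists>f g. dig_cont X \<kappa> Y \<mu> f \<and> dig_cont Y \<mu> X \<kappa> g \<and> f x0 = y0 \<and> g y0 = x0 \<and>
        (\<exists>F. pointed_real_homotopy X \<kappa> x0 X \<kappa> x0 (g \<circ> f) id F) \<and>
        (\<exists>G. pointed_real_homotopy Y \<mu> y0 Y \<mu> y0 (f \<circ> g) id G))"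


section \<open>The fundamental group\<close>

definition dig_homotopy ::
    "'a set \<Rightarrow> ('a \<Rightarrow> 'a \<Rightarrow> bool) \<Rightarrow> 'b set \<Rightarrow> ('b \<Rightarrow> 'b \<Rightarrow> bool) \<Rightarrow>
     nat \<Rightarrow> ('a \<Rightarrow> 'b) \<Rightarrow> ('a \<Rightarrow> 'b) \<Rightarrow> ('a \<Rightarrow> nat \<Rightarrow> 'b) \<Rightarrow> bool" where
  "dig_homotopy X \<kappa> Y \<mu> m f g F \<longleftrightarrow>
     m > 0 \<and> dig_cont X \<kappa> Y \<mu> f \<and> dig_cont X \<kappa> Y \<mu> g \<and>
     (\<forall>x\<in>X. F x 0 = f x \<and> F x m = g x) \<and>
     (\<forall>x\<in>X. dig_cont {0..m} consec Y \<mu> (F x)) \<and>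
     (\<forall>t\<in>{0..m}. dig_cont X \<kappa> Y \<mu> (\<lambda>x. F x t))"

definition ec_path :: "'a set \<Rightarrow> ('a \<Rightarrow> 'a \<Rightarrow> bool) \<Rightarrow> (nat \<Rightarrow> 'a) \<Rightarrow> bool" where
  "ec_path X \<kappa> f \<longleftrightarrow> dig_cont UNIV consec X \<kappa> f \<and> (\<exists>c. \<exists>N. \<forall>n\<ge>N. f n = c)"

definition ec_end :: "(nat \<Rightarrow> 'a) \<Rightarrow> 'a" where
  "ec_end f = (THE c. \<exists>N. \<forall>n\<ge>N. f n = c)"

definition ec_loops :: "'a set \<Rightarrow> ('a \<Rightarrow> 'a \<Rightarrow> bool) \<Rightarrow> 'a \<Rightarrow> (nat \<Rightarrow> 'a) set" where
  "ec_loops X \<kappa> x0 = {f. ec_path X \<kappa> f \<and> f 0 = x0 \<and> ec_end f = x0}"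

text \<open>The homotopy parameter is the first argument of \<open>H\<close>.\<close>

definition ec_homotopy ::
    "'a set \<Rightarrow> ('a \<Rightarrow> 'a \<Rightarrow> bool) \<Rightarrow> nat \<Rightarrow> (nat \<Rightarrow> 'a) \<Rightarrow> (nat \<Rightarrow> 'a) \<Rightarrow>
     (nat \<Rightarrow> nat \<Rightarrow> 'a) \<Rightarrow> bool" where
  "ec_homotopy X \<kappa> k f g H \<longleftrightarrow>
     dig_homotopy UNIV consec X \<kappa> k f g (\<lambda>t s. H s t) \<and> (\<forall>s\<in>{0..k}. ec_path X \<kappa> (H s))"

definition holds_endpoints_fixed ::
    "nat \<Rightarrow> (nat \<Rightarrow> 'a) \<Rightarrow> (nat \<Rightarrow> 'a) \<Rightarrow> (nat \<Rightarrow> nat \<Rightarrow> 'a) \<Rightarrow> bool" where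
  "holds_endpoints_fixed k f g H \<longleftrightarrow>
     (\<forall>s\<in>{0..k}. H s 0 = f 0 \<and> f 0 = g 0) \<and>
     (\<exists>c\<ge>1. \<forall>n\<ge>c. \<forall>s\<in>{0..k}. H s n = f n \<and> f n = g n)"

definition loop_rel ::
    "'a set \<Rightarrow> ('a \<Rightarrow> 'a \<Rightarrow> bool) \<Rightarrow> 'a \<Rightarrow> ((nat \<Rightarrow> 'a) \<times> (nat \<Rightarrow> 'a)) set" where
  "loop_rel X \<kappa> x0 =
     {(f, g). f \<in> ec_loops X \<kappa> x0 \<and> g \<in> ec_loops X \<kappa> x0 \<and>
        (\<exists>k H. ec_homotopy X \<kappa> k f g H \<and> holds_endpoints_fixed k f g H)}"

definition stab :: "(nat \<Rightarrow> 'a) \<Rightarrow> nat" where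
  "stab f = (LEAST m. \<forall>n\<ge>m. f n = f m)"

text \<open>For loops with a common base point both branches agree at \<open>n = stab f\<close>.\<close>

definition loop_concat :: "(nat \<Rightarrow> 'a) \<Rightarrow> (nat \<Rightarrow> 'a) \<Rightarrow> nat \<Rightarrow> 'a" where
  "loop_concat f g n = (if n \<le> stab f then f n else g (n - stab f))"

text \<open>
  The union in the product runs over all representatives; as the class of a concatenation does not
  depend on them, it is the class of \<open>loop_concat f g\<close> for any \<open>f \<in> A\<close> and \<open>g \<in> B\<close>.
\<close>

definition fundamental_group ::
    "'a set \<Rightarrow> ('a \<Rightarrow> 'a \<Rightarrow> bool) \<Rightarrow> 'a \<Rightarrow> (nat \<Rightarrow> 'a) set monoid" where
  "fundamental_group X \<kappa> x0 =
     \<lparr>carrier = ec_loops X \<kappa> x0 // loop_rel X \<kappa> x0,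
      monoid.mult = (\<lambda>A B. \<Union>f\<in>A. \<Union>g\<in>B. loop_rel X \<kappa> x0 `` {loop_concat f g}),
      one = loop_rel X \<kappa> x0 `` {\<lambda>_. x0}\<rparr>"

end

theory Submission
  imports Defs
begin

text \<open>
  Two loops are equivalent iff they are linked by a finite chain of loops in which neighbours are
  pointwise equal or adjacent. A loop \<open>a\<close> takes finitely many values, so for a real homotopy \<open>F\<close>
  every time \<open>t\<close> has a neighbourhood in which the loops \<open>F(a(\<cdot>),s)\<close> and \<open>F(a(\<cdot>),t)\<close> are
  pointwise equal or adjacent; by compactness of the unit interval \<open>F(a(\<cdot>),0)\<close> and
  \<open>F(a(\<cdot>),1)\<close> are equivalent. Hence the homomorphisms induced by the two maps of a pointed
  real homotopy equivalence are mutually inverse. They are homomorphisms, although composition with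
  a map may shorten a loop, because delaying the second factor of a concatenation by one time unit
  changes it pointwise only to equal or adjacent points.
\<close>

section \<open>Continuity and adjacency\<close>

lemma adj_or_eq_refl [simp]: "adj_or_eq \<kappa> x x"
  by (simp add: adj_or_eq_def)

lemma adj_or_eq_sym:
  "\<lbrakk>symp_on X \<kappa>; x \<in> X; y \<in> X; adj_or_eq \<kappa> x y\<rbrakk> \<Longrightarrow> adj_or_eq \<kappa> y x"
  by (auto simp: adj_or_eq_def dest: symp_onD)

lemma symp_consec: "symp_on A consec"
  by (auto simp: symp_on_def consec_def)

text \<open>A chain that starts at \<open>u\<close> and ends at \<open>v\<close> must leave
  \<open>u\<close> at some moment, and inside \<open>{u, v}\<close> it can then only go to
  \<open>v\<close>.\<close>

lemma successively_two_points:
  assumes "p \<noteq> []" "hd p = u" "last p = v" "set p \<subseteq> {u, v}" "successively R p" "u \<noteq> v"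
  shows "R u v"
  using assms
proof (induction p)
  case (Cons x p)
  then show ?case by (cases p) auto
qed simp

text \<open>The image of an \<open>R\<close>-chain may repeat points, and \<open>S\<close> need not
  relate a point to itself. The witness \<open>q\<close> is therefore the image list with these
  repetitions dropped, not \<open>map f p\<close>.\<close>

lemma successively_refine:
  assumes "p \<noteq> []" "set p \<subseteq> A" "successively R p"
    and "\<And>x y. \<lbrakk>x \<in> A; y \<in> A; R x y\<rbrakk> \<Longrightarrow> adj_or_eq S (f x) (f y)"
  shows "\<exists>q. q \<noteq> [] \<and> hd q = f (hd p) \<and> last q = f (last p) \<and> set q \<subseteq> f ` A \<and> successively S q"
  using assms(1-3)
proof (induction p)
  case (Cons x p)
  show ?case
  proof (cases p)
    case Nil
    then show ?thesis using Cons.prems by (intro exI[of _ "[f x]"]) auto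
  next
    case (Cons y r)
    then obtain q where q: "q \<noteq> []" "hd q = f y" "last q = f (last p)" "set q \<subseteq> f ` A" "successively S q"
      using Cons.IH Cons.prems by auto
    have "adj_or_eq S (f x) (f y)"
      using Cons Cons.prems assms(4) by auto
    then consider "f x = f y" | "S (f x) (f y)" by (auto simp: adj_or_eq_def)
    then show ?thesis
    proof cases
      case 1
      then show ?thesis using q Cons by (intro exI[of _ q]) auto
    next
      case 2
      then show ?thesis using q Cons Cons.prems
        by (intro exI[of _ "f x # q"]) (auto simp: successively_Cons)
    qed
  qed
qed simp

lemma dig_cont_iff:
  assumes "symp_on X \<kappa>"
  shows "dig_cont X \<kappa> Y \<mu> f \<longleftrightarrow>
    f ` X \<subseteq> Y \<and> (\<forall>x\<in>X. \<forall>y\<in>X. \<kappa> x y \<longrightarrow> adj_or_eq \<mu> (f x) (f y))" (is "?L \<longleftrightarrow> ?R")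
proof
  assume L: ?L
  have "adj_or_eq \<mu> (f x) (f y)" if "x \<in> X" "y \<in> X" "\<kappa> x y" for x y
  proof (cases "f x = f y")
    case False
    \<comment> \<open>Connectedness asks for a chain in either direction, so both orientations of
      the edge are needed.\<close>
    have "\<kappa> y x" using that assms by (auto dest: symp_onD)
    then have "dig_connected \<kappa> {x, y}"
      using that by (auto simp: dig_connected_def intro: exI[of _ "[x, y]"] exI[of _ "[y, x]"])
    then have "dig_connected \<mu> {f x, f y}"
      using L that by (force simp: dig_cont_def dest: spec[of _ "{x, y}"])
    then obtain p where "p \<noteq> []" "hd p = f x" "last p = f y" "set p \<subseteq> {f x, f y}" "successively \<mu> p"
      using False unfolding dig_connected_def by blast
    then have "\<mu> (f x) (f y)" using False by (rule successively_two_points)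
    then show ?thesis by (simp add: adj_or_eq_def)
  qed simp
  then show ?R using L by (auto simp: dig_cont_def)
next
  assume R: ?R
  have "dig_connected \<mu> (f ` A)" if A: "A \<subseteq> X" "dig_connected \<kappa> A" for A
    unfolding dig_connected_def
  proof (intro ballI impI)
    fix u v assume "u \<in> f ` A" "v \<in> f ` A" "u \<noteq> v"
    then obtain x y where xy: "x \<in> A" "y \<in> A" "x \<noteq> y" "u = f x" "v = f y" by blast
    then obtain p where p: "p \<noteq> []" "hd p = x" "last p = y" "set p \<subseteq> A" "successively \<kappa> p"
      using A(2) unfolding dig_connected_def by blast
    show "\<exists>q. q \<noteq> [] \<and> hd q = u \<and> last q = v \<and> set q \<subseteq> f ` A \<and> successively \<mu> q"
      using successively_refine[OF p(1,4,5), of \<mu> f] R A(1) p(2,3) xy(4,5) by blast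
  qed
  then show ?L using R by (simp add: dig_cont_def)
qed

lemma dig_cont_adj_or_eq:
  assumes "symp_on X \<kappa>" "dig_cont X \<kappa> Y \<mu> f" "x \<in> X" "y \<in> X" "adj_or_eq \<kappa> x y"
  shows "adj_or_eq \<mu> (f x) (f y)"
  using assms by (auto simp: dig_cont_iff adj_or_eq_def)

lemma dig_cont_comp:
  assumes "dig_cont X \<kappa> Y \<mu> f" "dig_cont Y \<mu> Z \<nu> g"
  shows "dig_cont X \<kappa> Z \<nu> (g \<circ> f)"
  unfolding dig_cont_def
proof (intro conjI allI impI)
  show "(g \<circ> f) ` X \<subseteq> Z" using assms by (auto simp: dig_cont_def)
next
  fix A assume A: "A \<subseteq> X" "dig_connected \<kappa> A"
  then have "dig_connected \<mu> (f ` A)" "f ` A \<subseteq> Y" using assms(1) by (auto simp: dig_cont_def)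
  then show "dig_connected \<nu> ((g \<circ> f) ` A)"
    using assms(2) by (auto simp: dig_cont_def image_comp)
qed

text \<open>Symmetry of \<kappa> supplies the backward direction, so only the step from
  \<open>n\<close> to \<open>Suc n\<close> has to be checked.\<close>

lemma dig_cont_consec_iff:
  assumes "symp_on X \<kappa>"
  shows "dig_cont UNIV consec X \<kappa> f \<longleftrightarrow> range f \<subseteq> X \<and> (\<forall>n. adj_or_eq \<kappa> (f n) (f (Suc n)))"
proof -
  have "adj_or_eq \<kappa> (f (Suc n)) (f n)" if "range f \<subseteq> X" "adj_or_eq \<kappa> (f n) (f (Suc n))" for n
    using that by (intro adj_or_eq_sym[OF assms _ _ that(2)]) auto
  then show ?thesis
    unfolding dig_cont_iff[OF symp_consec] consec_def by blast
qed

lemma dig_cont_segment_iff: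
  assumes "symp_on X \<kappa>"
  shows "dig_cont {0..k} consec X \<kappa> f \<longleftrightarrow>
    f ` {0..k} \<subseteq> X \<and> (\<forall>n<k. adj_or_eq \<kappa> (f n) (f (Suc n)))"
proof -
  have "adj_or_eq \<kappa> (f (Suc n)) (f n)"
    if "f ` {0..k} \<subseteq> X" "n < k" "adj_or_eq \<kappa> (f n) (f (Suc n))" for n
    using that by (intro adj_or_eq_sym[OF assms _ _ that(3)]) auto
  then show ?thesis
    unfolding dig_cont_iff[OF symp_consec] consec_def by fastforce
qed

section \<open>Loops and one-step homotopies\<close>

lemma ec_end_eqI:
  assumes "\<forall>n\<ge>N. f n = c"
  shows "ec_end f = c"
  unfolding ec_end_def
proof (rule the_equality)
  fix d assume "\<exists>M. \<forall>n\<ge>M. f n = d"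
  then obtain M where "\<forall>n\<ge>M. f n = d" by blast
  then show "d = c" using assms by (metis max.cobounded1 max.cobounded2)
qed (use assms in blast)

text \<open>Eliminates the definite description in \<open>ec_end\<close>: an eventual value is
  unique, so ending at \<open>x0\<close> means being eventually \<open>x0\<close>.\<close>

lemma ec_loops_dig_cont_iff:
  "f \<in> ec_loops X \<kappa> x0 \<longleftrightarrow>
    dig_cont UNIV consec X \<kappa> f \<and> f 0 = x0 \<and> (\<exists>N. \<forall>n\<ge>N. f n = x0)"
  unfolding ec_loops_def ec_path_def mem_Collect_eq using ec_end_eqI by metis

lemma ec_loops_iff:
  assumes "symp_on X \<kappa>"
  shows "f \<in> ec_loops X \<kappa> x0 \<longleftrightarrow>
    range f \<subseteq> X \<and> (\<forall>n. adj_or_eq \<kappa> (f n) (f (Suc n))) \<and> f 0 = x0 \<and> (\<exists>N. \<forall>n\<ge>N. f n = x0)"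
  by (auto simp: ec_loops_dig_cont_iff dig_cont_consec_iff[OF assms])

lemma ec_loops_comp:
  assumes "dig_cont X \<kappa> Y \<mu> f" "f x0 = y0" "a \<in> ec_loops X \<kappa> x0"
  shows "f \<circ> a \<in> ec_loops Y \<mu> y0"
  using assms dig_cont_comp[OF _ assms(1)] unfolding ec_loops_dig_cont_iff by (metis comp_apply)

lemma ec_loops_in: "a \<in> ec_loops X \<kappa> x0 \<Longrightarrow> a n \<in> X"
  by (auto simp: ec_loops_dig_cont_iff dig_cont_def)

text \<open>A homotopy of length one. Its endpoints stay fixed automatically, since both members are
  loops at \<open>x0\<close>.\<close>

definition loop_step ::
    "'a set \<Rightarrow> ('a \<Rightarrow> 'a \<Rightarrow> bool) \<Rightarrow> 'a \<Rightarrow> ((nat \<Rightarrow> 'a) \<times> (nat \<Rightarrow> 'a)) set" where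
  "loop_step X \<kappa> x0 =
     {(f, g). f \<in> ec_loops X \<kappa> x0 \<and> g \<in> ec_loops X \<kappa> x0 \<and> (\<forall>n. adj_or_eq \<kappa> (f n) (g n))}"

text \<open>The chain, read as a function of two arguments, is itself the homotopy: continuity in
  time comes from the loops, continuity in the parameter from the steps.\<close>

lemma loop_step_chain_homotopy:
  assumes sym: "symp_on X \<kappa>" and "k > 0" and chain: "\<And>i. i < k \<Longrightarrow> (H i, H (Suc i)) \<in> loop_step X \<kappa> x0"
  shows "(H 0, H k) \<in> loop_rel X \<kappa> x0"
proof -
  \<comment> \<open>The last loop \<open>H k\<close> starts no step; it is reached as the target of
    the step from \<open>k - 1\<close>.\<close>
  have loops: "H s \<in> ec_loops X \<kappa> x0" if "s \<le> k" for s
    using chain[of s] chain[of "s - 1"] that \<open>k > 0\<close>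
    by (cases "s < k") (auto simp: loop_step_def)
  have "\<forall>s\<in>{0..k}. \<exists>N. \<forall>n\<ge>N. H s n = x0"
    using loops by (auto simp: ec_loops_dig_cont_iff)
  then obtain N where N: "\<And>s n. \<lbrakk>s \<le> k; n \<ge> N s\<rbrakk> \<Longrightarrow> H s n = x0"
    by (metis atLeastAtMost_iff bchoice le0)
  \<comment> \<open>A common stage from which all of the finitely many loops rest at
    \<open>x0\<close>; \<open>Suc\<close> secures the required \<open>c \<ge> 1\<close>.\<close>
  define c where "c = Suc (Max (N ` {0..k}))"
  have "N s \<le> c" if "s \<le> k" for s
  proof -
    have "N s \<le> Max (N ` {0..k})" using that by (intro Max_ge) auto
    then show ?thesis by (simp add: c_def)
  qed
  then have c: "H s n = x0" if "s \<le> k" "n \<ge> c" for s n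
    using N that by (meson order_trans)
  have "holds_endpoints_fixed k (H 0) (H k) H"
    unfolding holds_endpoints_fixed_def
  proof (intro conjI)
    show "\<forall>s\<in>{0..k}. H s 0 = H 0 0 \<and> H 0 0 = H k 0"
      using loops by (auto simp: ec_loops_def)
    show "\<exists>c\<ge>1. \<forall>n\<ge>c. \<forall>s\<in>{0..k}. H s n = H 0 n \<and> H 0 n = H k n"
      using c by (intro exI[of _ c]) (auto simp: c_def)
  qed
  moreover have "ec_homotopy X \<kappa> k (H 0) (H k) H"
    unfolding ec_homotopy_def dig_homotopy_def dig_cont_segment_iff[OF sym]
    using \<open>k > 0\<close> loops chain ec_loops_in[OF loops]
    by (auto simp: loop_step_def ec_loops_def ec_path_def)
  ultimately show ?thesis
    using loops by (auto simp: loop_rel_def)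
qed

text \<open>The slices of a homotopy form a chain of steps, and conversely. The closure is not the
  reflexive one, which would also relate functions that are not loops; reflexivity on loops is
  already present in \<open>loop_step\<close>.\<close>

lemma loop_rel_eq_trancl:
  assumes sym: "symp_on X \<kappa>"
  shows "loop_rel X \<kappa> x0 = (loop_step X \<kappa> x0)\<^sup>+"
proof (intro equalityI subrelI)
  fix f g assume "(f, g) \<in> loop_rel X \<kappa> x0"
  then obtain k H where f: "f \<in> ec_loops X \<kappa> x0" and H: "ec_homotopy X \<kappa> k f g H"
    and E: "holds_endpoints_fixed k f g H"
    by (auto simp: loop_rel_def)
  have k: "k > 0" and ends: "H 0 = f" "H k = g"
    using H by (auto simp: ec_homotopy_def dig_homotopy_def)
  obtain c where c: "\<And>n s. \<lbrakk>n \<ge> c; s \<le> k\<rbrakk> \<Longrightarrow> H s n = f n"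
    using E unfolding holds_endpoints_fixed_def by fastforce
  obtain N where N: "\<And>n. n \<ge> N \<Longrightarrow> f n = x0"
    using f by (auto simp: ec_loops_dig_cont_iff)
  \<comment> \<open>An EC homotopy only makes the slices EC paths; that they are loops at
    \<open>x0\<close> comes from the fixed endpoints.\<close>
  have loops: "H s \<in> ec_loops X \<kappa> x0" if "s \<le> k" for s
    unfolding ec_loops_dig_cont_iff
  proof (intro conjI)
    show "dig_cont UNIV consec X \<kappa> (H s)" using H that by (simp add: ec_homotopy_def dig_homotopy_def)
    show "H s 0 = x0" using E f that by (simp add: holds_endpoints_fixed_def ec_loops_def)
    show "\<exists>N. \<forall>n\<ge>N. H s n = x0" using c N that by (intro exI[of _ "max c N"]) auto
  qed
  have step: "(H s, H (Suc s)) \<in> loop_step X \<kappa> x0" if "s < k" for s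
    using loops that H
    by (auto simp: loop_step_def ec_homotopy_def dig_homotopy_def dig_cont_segment_iff[OF sym])
  have "(f, g) \<in> loop_step X \<kappa> x0 ^^ k"
    unfolding relpow_fun_conv using ends step by blast
  then show "(f, g) \<in> (loop_step X \<kappa> x0)\<^sup>+"
    using k trancl_power by blast
next
  fix f g assume "(f, g) \<in> (loop_step X \<kappa> x0)\<^sup>+"
  then obtain k where "k > 0" "(f, g) \<in> loop_step X \<kappa> x0 ^^ k"
    using trancl_power by blast
  then show "(f, g) \<in> loop_rel X \<kappa> x0"
    unfolding relpow_fun_conv using loop_step_chain_homotopy[OF sym] by blast
qed

lemma loop_step_imp_loop_rel:
  "\<lbrakk>symp_on X \<kappa>; (f, g) \<in> loop_step X \<kappa> x0\<rbrakk> \<Longrightarrow> (f, g) \<in> loop_rel X \<kappa> x0"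
  by (simp add: loop_rel_eq_trancl)

lemma equiv_loop_rel:
  assumes sym: "symp_on X \<kappa>"
  shows "equiv (ec_loops X \<kappa> x0) (loop_rel X \<kappa> x0)"
proof (intro equivI)
  show "loop_rel X \<kappa> x0 \<subseteq> ec_loops X \<kappa> x0 \<times> ec_loops X \<kappa> x0"
    by (auto simp: loop_rel_def)
  show "refl_on (ec_loops X \<kappa> x0) (loop_rel X \<kappa> x0)"
    by (auto simp: refl_on_def loop_step_def intro: loop_step_imp_loop_rel[OF sym])
  have "sym (loop_step X \<kappa> x0)"
    using adj_or_eq_sym[OF sym] ec_loops_in by (fastforce simp: loop_step_def intro!: symI)
  then show "sym (loop_rel X \<kappa> x0)"
    by (simp add: loop_rel_eq_trancl[OF sym] sym_trancl)
  show "trans (loop_rel X \<kappa> x0)"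
    by (simp add: loop_rel_eq_trancl[OF sym])
qed

lemma loop_rel_sym: "\<lbrakk>symp_on X \<kappa>; (a, b) \<in> loop_rel X \<kappa> x0\<rbrakk> \<Longrightarrow> (b, a) \<in> loop_rel X \<kappa> x0"
  using equiv_loop_rel[of X \<kappa> x0] unfolding equiv_def by (blast dest: symD)

lemma loop_rel_trans:
  "\<lbrakk>symp_on X \<kappa>; (a, b) \<in> loop_rel X \<kappa> x0; (b, c) \<in> loop_rel X \<kappa> x0\<rbrakk> \<Longrightarrow> (a, c) \<in> loop_rel X \<kappa> x0"
  by (simp add: loop_rel_eq_trancl)

text \<open>Reduces well-definedness on classes to a single step, by induction along the
  chain.\<close>

lemma loop_rel_congruent:
  assumes sym: "symp_on X \<kappa>" and ev: "equiv B r"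
    and step: "\<And>a b. (a, b) \<in> loop_step X \<kappa> x0 \<Longrightarrow> (\<Phi> a, \<Phi> b) \<in> r"
    and ab: "(a, b) \<in> loop_rel X \<kappa> x0"
  shows "(\<Phi> a, \<Phi> b) \<in> r"
proof -
  have "trans r" using ev by (simp add: equiv_def)
  from ab[unfolded loop_rel_eq_trancl[OF sym]] show ?thesis
  proof (induction rule: trancl_induct)
    case (step b c)
    then show ?case using assms(3) transD[OF \<open>trans r\<close>] by blast
  qed (rule step)
qed

section \<open>Concatenation\<close>

text \<open>Concatenation with a free switching time \<open>M\<close>. The time
  \<open>stab f\<close> used by \<open>loop_concat\<close> can change under a step or under
  composition with a map, whereas a fixed \<open>M\<close> does not.\<close>

definition concat_at :: "nat \<Rightarrow> (nat \<Rightarrow> 'a) \<Rightarrow> (nat \<Rightarrow> 'a) \<Rightarrow> nat \<Rightarrow> 'a" where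
  "concat_at M f g n = (if n \<le> M then f n else g (n - M))"

lemma loop_concat_eq: "loop_concat f g = concat_at (stab f) f g"
  by (rule ext) (simp add: loop_concat_def concat_at_def)

lemma comp_concat_at: "h \<circ> concat_at M f g = concat_at M (h \<circ> f) (h \<circ> g)"
  by (rule ext) (simp add: concat_at_def)

lemma stab_settled:
  assumes "a \<in> ec_loops X \<kappa> x0" "stab a \<le> n"
  shows "a n = x0"
proof -
  obtain N where N: "\<forall>n\<ge>N. a n = x0" using assms(1) by (auto simp: ec_loops_dig_cont_iff)
  then have "\<forall>n\<ge>N. a n = a N" by simp
  then have "\<forall>n\<ge>stab a. a n = a (stab a)" unfolding stab_def by (rule LeastI)
  then show ?thesis using N assms(2) by (metis max.cobounded1 max.cobounded2)
qed

lemma stab_le: "\<forall>n\<ge>M. a n = x0 \<Longrightarrow> stab a \<le> M"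
  unfolding stab_def by (rule Least_le) auto

lemma concat_at_loop:
  assumes sym: "symp_on X \<kappa>" and a: "a \<in> ec_loops X \<kappa> x0" and b: "b \<in> ec_loops X \<kappa> x0"
    and M: "stab a \<le> M"
  shows "concat_at M a b \<in> ec_loops X \<kappa> x0"
proof -
  obtain N where N: "\<forall>n\<ge>N. b n = x0" using b by (auto simp: ec_loops_dig_cont_iff)
  have "adj_or_eq \<kappa> (concat_at M a b n) (concat_at M a b (Suc n))" for n
  proof -
    \<comment> \<open>At the junction \<open>n = M\<close> the next value is \<open>b 1\<close>, so
      the last value of \<open>a\<close> has to be recognised as \<open>b 0\<close>.\<close>
    have "a M = b 0" using stab_settled[OF a M] b by (simp add: ec_loops_def)
    moreover have "adj_or_eq \<kappa> (a n) (a (Suc n))" "adj_or_eq \<kappa> (b (n - M)) (b (Suc (n - M)))"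
      using a b by (auto simp: ec_loops_iff[OF sym])
    ultimately show ?thesis
      by (cases n M rule: linorder_cases) (auto simp: concat_at_def Suc_diff_le)
  qed
  moreover have "range (concat_at M a b) \<subseteq> X"
    using a b by (auto simp: concat_at_def ec_loops_in)
  \<comment> \<open>\<open>Suc\<close> puts \<open>n\<close> strictly beyond \<open>M\<close>, into
    the branch governed by \<open>b\<close>.\<close>
  moreover have "\<forall>n\<ge>Suc (M + N). concat_at M a b n = x0"
    using N by (auto simp: concat_at_def)
  moreover have "concat_at M a b 0 = x0" using a by (simp add: concat_at_def ec_loops_def)
  ultimately show ?thesis unfolding ec_loops_iff[OF sym] by blast
qed

text \<open>Beyond \<open>M\<close>, the delayed loop takes at \<open>n\<close> the value that the
  other takes at \<open>n - 1\<close>, and consecutive values of a loop are equal or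
  adjacent.\<close>

lemma concat_at_delay:
  assumes sym: "symp_on X \<kappa>" and a: "a \<in> ec_loops X \<kappa> x0" and b: "b \<in> ec_loops X \<kappa> x0"
    and M: "stab a \<le> M"
  shows "(concat_at (Suc M) a b, concat_at M a b) \<in> loop_step X \<kappa> x0"
proof -
  let ?c = "concat_at M a b"
  have c: "?c \<in> ec_loops X \<kappa> x0" by (rule concat_at_loop[OF assms])
  have b0: "b 0 = x0" using b by (simp add: ec_loops_def)
  have "adj_or_eq \<kappa> (concat_at (Suc M) a b n) (?c n)" for n
  proof (cases "n \<le> M")
    case True
    then show ?thesis by (simp add: concat_at_def)
  next
    case False
    then obtain m where m: "n = Suc m" "m \<ge> M" by (cases n) auto
    then have "concat_at (Suc M) a b n = ?c m"
      using stab_settled[OF a] M b0 by (auto simp: concat_at_def not_le)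
    then show ?thesis using c m by (simp add: ec_loops_iff[OF sym])
  qed
  then show ?thesis using c concat_at_loop[OF sym a b, of "Suc M"] M by (simp add: loop_step_def)
qed

text \<open>The switching time is lowered from \<open>M\<close> to \<open>stab a\<close> one delay
  at a time.\<close>

lemma concat_at_loop_concat:
  assumes sym: "symp_on X \<kappa>" and a: "a \<in> ec_loops X \<kappa> x0" and b: "b \<in> ec_loops X \<kappa> x0"
    and M: "stab a \<le> M"
  shows "(concat_at M a b, loop_concat a b) \<in> loop_rel X \<kappa> x0"
  using M
proof (induction M rule: dec_induct)
  case base
  then show ?case
    using equiv_loop_rel[OF sym, of x0] concat_at_loop[OF sym a b order.refl]
    by (auto simp: loop_concat_eq equiv_def dest: refl_onD)
next
  case (step M)
  have "(concat_at (Suc M) a b, concat_at M a b) \<in> loop_rel X \<kappa> x0"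
    using concat_at_delay[OF sym a b] step.hyps by (intro loop_step_imp_loop_rel[OF sym]) simp
  then show ?case
    using step.IH by (rule loop_rel_trans[OF sym])
qed

lemma loop_concat_step:
  assumes sym: "symp_on X \<kappa>"
    and a: "(a, a') \<in> loop_step X \<kappa> x0" and b: "(b, b') \<in> loop_step X \<kappa> x0"
  shows "(loop_concat a b, loop_concat a' b') \<in> loop_rel X \<kappa> x0"
proof -
  \<comment> \<open>The two first factors may settle at different times; switching both at the later
    one lets the concatenations be compared pointwise.\<close>
  let ?M = "max (stab a) (stab a')"
  have L: "a \<in> ec_loops X \<kappa> x0" "a' \<in> ec_loops X \<kappa> x0" "b \<in> ec_loops X \<kappa> x0" "b' \<in> ec_loops X \<kappa> x0"
    using a b by (auto simp: loop_step_def)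
  have "(concat_at ?M a b, concat_at ?M a' b') \<in> loop_step X \<kappa> x0"
    using a b concat_at_loop[OF sym L(1,3)] concat_at_loop[OF sym L(2,4)]
    by (auto simp: loop_step_def concat_at_def)
  then have "(concat_at ?M a b, concat_at ?M a' b') \<in> loop_rel X \<kappa> x0"
    by (rule loop_step_imp_loop_rel[OF sym])
  moreover have "(concat_at ?M a b, loop_concat a b) \<in> loop_rel X \<kappa> x0"
    "(concat_at ?M a' b', loop_concat a' b') \<in> loop_rel X \<kappa> x0"
    using concat_at_loop_concat[OF sym] L by auto
  ultimately show ?thesis
    using loop_rel_sym[OF sym] loop_rel_trans[OF sym] by metis
qed

lemma congruent2_loop_concat:
  assumes sym: "symp_on X \<kappa>"
  shows "congruent2 (loop_rel X \<kappa> x0) (loop_rel X \<kappa> x0) (\<lambda>a b. loop_rel X \<kappa> x0 `` {loop_concat a b})"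
proof (rule congruent2I)
  note ev = equiv_loop_rel[OF sym, of x0]
  show "equiv (ec_loops X \<kappa> x0) (loop_rel X \<kappa> x0)" by (rule ev)
  then show "equiv (ec_loops X \<kappa> x0) (loop_rel X \<kappa> x0)" .
  \<comment> \<open>Congruence is checked in one argument at a time; the other factor makes the
    trivial step.\<close>
  have refl: "(a, a) \<in> loop_step X \<kappa> x0" if "a \<in> ec_loops X \<kappa> x0" for a
    using that by (simp add: loop_step_def)
  fix a b c assume c: "c \<in> ec_loops X \<kappa> x0" and ab: "(a, b) \<in> loop_rel X \<kappa> x0"
  show "loop_rel X \<kappa> x0 `` {loop_concat a c} = loop_rel X \<kappa> x0 `` {loop_concat b c}"
    using loop_rel_congruent[OF sym ev loop_concat_step[OF sym _ refl[OF c]] ab]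
    by (rule equiv_class_eq[OF ev])
  show "loop_rel X \<kappa> x0 `` {loop_concat c a} = loop_rel X \<kappa> x0 `` {loop_concat c b}"
    using loop_rel_congruent[OF sym ev loop_concat_step[OF sym refl[OF c]] ab]
    by (rule equiv_class_eq[OF ev])
qed

lemma mult_fundamental_group:
  assumes "symp_on X \<kappa>" "a \<in> ec_loops X \<kappa> x0" "b \<in> ec_loops X \<kappa> x0"
  shows "loop_rel X \<kappa> x0 `` {a} \<otimes>\<^bsub>fundamental_group X \<kappa> x0\<^esub> loop_rel X \<kappa> x0 `` {b} =
    loop_rel X \<kappa> x0 `` {loop_concat a b}"
  using UN_equiv_class2[OF equiv_loop_rel equiv_loop_rel congruent2_loop_concat] assms
  by (simp add: fundamental_group_def)

section \<open>Induced homomorphisms\<close>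

text \<open>The union over all representatives avoids a choice; \<open>induced_class\<close> shows
  that any one of them gives the same class.\<close>

definition induced ::
    "'b set \<Rightarrow> ('b \<Rightarrow> 'b \<Rightarrow> bool) \<Rightarrow> 'b \<Rightarrow> ('a \<Rightarrow> 'b) \<Rightarrow> (nat \<Rightarrow> 'a) set \<Rightarrow> (nat \<Rightarrow> 'b) set" where
  "induced Y \<mu> y0 f A = (\<Union>a\<in>A. loop_rel Y \<mu> y0 `` {f \<circ> a})"

lemma induced_class:
  assumes symX: "symp_on X \<kappa>" and symY: "symp_on Y \<mu>"
    and f: "dig_cont X \<kappa> Y \<mu> f" "f x0 = y0" and a: "a \<in> ec_loops X \<kappa> x0"
  shows "induced Y \<mu> y0 f (loop_rel X \<kappa> x0 `` {a}) = loop_rel Y \<mu> y0 `` {f \<circ> a}"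
  unfolding induced_def
proof (rule UN_equiv_class[OF equiv_loop_rel[OF symX] _ a], rule congruentI)
  note evY = equiv_loop_rel[OF symY, of y0]
  fix b c assume bc: "(b, c) \<in> loop_rel X \<kappa> x0"
  have "(f \<circ> b, f \<circ> c) \<in> loop_rel Y \<mu> y0"
  proof (rule loop_rel_congruent[OF symX evY _ bc])
    \<comment> \<open>A continuous map keeps points equal or adjacent, so it carries steps to
      steps.\<close>
    fix b c assume "(b, c) \<in> loop_step X \<kappa> x0"
    then have "(f \<circ> b, f \<circ> c) \<in> loop_step Y \<mu> y0"
      using ec_loops_comp[OF f] dig_cont_adj_or_eq[OF symX f(1)] ec_loops_in
      by (fastforce simp: loop_step_def)
    then show "(f \<circ> b, f \<circ> c) \<in> loop_rel Y \<mu> y0" by (rule loop_step_imp_loop_rel[OF symY])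
  qed
  then show "loop_rel Y \<mu> y0 `` {f \<circ> b} = loop_rel Y \<mu> y0 `` {f \<circ> c}"
    by (rule equiv_class_eq[OF evY])
qed

lemma induced_hom:
  assumes symX: "symp_on X \<kappa>" and symY: "symp_on Y \<mu>"
    and f: "dig_cont X \<kappa> Y \<mu> f" "f x0 = y0"
  shows "induced Y \<mu> y0 f \<in> hom (fundamental_group X \<kappa> x0) (fundamental_group Y \<mu> y0)"
proof (rule homI)
  fix A assume "A \<in> carrier (fundamental_group X \<kappa> x0)"
  then obtain a where "a \<in> ec_loops X \<kappa> x0" "A = loop_rel X \<kappa> x0 `` {a}"
    by (auto simp: fundamental_group_def elim: quotientE)
  then show "induced Y \<mu> y0 f A \<in> carrier (fundamental_group Y \<mu> y0)"
    using induced_class[OF symX symY f] ec_loops_comp[OF f]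
    by (simp add: fundamental_group_def quotientI)
next
  fix A B assume "A \<in> carrier (fundamental_group X \<kappa> x0)" "B \<in> carrier (fundamental_group X \<kappa> x0)"
  then obtain a b where a: "a \<in> ec_loops X \<kappa> x0" "A = loop_rel X \<kappa> x0 `` {a}"
    and b: "b \<in> ec_loops X \<kappa> x0" "B = loop_rel X \<kappa> x0 `` {b}"
    by (auto simp: fundamental_group_def elim!: quotientE)
  have fa: "f \<circ> a \<in> ec_loops Y \<mu> y0" and fb: "f \<circ> b \<in> ec_loops Y \<mu> y0"
    using a b ec_loops_comp[OF f] by auto
  \<comment> \<open>The map may send the final stretch of \<open>a\<close> to \<open>y0\<close>
    early. So \<open>f \<circ> loop_concat a b\<close> switches at \<open>stab a\<close>, possibly
    later than \<open>loop_concat (f \<circ> a) (f \<circ> b)\<close> does, and the two are only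
    equivalent.\<close>
  have "stab (f \<circ> a) \<le> stab a"
    using stab_settled[OF a(1)] f(2) by (intro stab_le[of _ _ y0]) simp
  then have "(f \<circ> loop_concat a b, loop_concat (f \<circ> a) (f \<circ> b)) \<in> loop_rel Y \<mu> y0"
    using concat_at_loop_concat[OF symY fa fb] by (simp add: loop_concat_eq comp_concat_at)
  then have "loop_rel Y \<mu> y0 `` {f \<circ> loop_concat a b} = loop_rel Y \<mu> y0 `` {loop_concat (f \<circ> a) (f \<circ> b)}"
    by (rule equiv_class_eq[OF equiv_loop_rel[OF symY]])
  moreover have "loop_concat a b \<in> ec_loops X \<kappa> x0"
    using concat_at_loop[OF symX a(1) b(1)] by (simp add: loop_concat_eq)
  ultimately show "induced Y \<mu> y0 f (A \<otimes>\<^bsub>fundamental_group X \<kappa> x0\<^esub> B) =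
      induced Y \<mu> y0 f A \<otimes>\<^bsub>fundamental_group Y \<mu> y0\<^esub> induced Y \<mu> y0 f B"
    using a b fa fb by (simp add: mult_fundamental_group symX symY induced_class[OF symX symY f])
qed

section \<open>Real homotopies\<close>

text \<open>Near an interior \<open>t\<close> the path takes at most the two one-sided values and
  \<open>p t\<close>; since \<open>p t\<close> is one of these two adjacent or equal values, it is
  close to both. At the ends there is one side only.\<close>

lemma real_path_locally_adjacent:
  assumes sym: "symp_on Y \<mu>" and p: "real_path Y \<mu> p" and t: "t \<in> {0..1}"
  shows "\<exists>d>0. \<forall>s\<in>{0..1}. \<bar>s - t\<bar> < d \<longrightarrow> adj_or_eq \<mu> (p s) (p t)"
proof -
  have inY: "p s \<in> Y" if "s \<in> {0..1}" for s
    using p that by (auto simp: real_path_def)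
  consider "t = 0" | "t = 1" | "t \<in> {0<..<1}" using t by fastforce
  then show ?thesis
  proof cases
    case 1
    from p obtain e a where e: "e > 0" "\<forall>s\<in>{0<..<e}. p s = a" "adj_or_eq \<mu> a (p 0)"
      unfolding real_path_def by blast
    have "adj_or_eq \<mu> (p s) (p t)" if "s \<in> {0..1}" "\<bar>s - t\<bar> < e" for s
      using that e 1 by (cases "s = 0") auto
    then show ?thesis using e(1) by blast
  next
    case 2
    from p obtain e b where e: "e > 0" "\<forall>s\<in>{1-e<..<1}. p s = b" "adj_or_eq \<mu> b (p 1)"
      unfolding real_path_def by blast
    have "adj_or_eq \<mu> (p s) (p t)" if "s \<in> {0..1}" "\<bar>s - t\<bar> < e" for s
      using that e 2 by (cases "s = 1") auto
    then show ?thesis using e(1) by blast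
  next
    case 3
    with p obtain e a b where e: "e > 0" "\<forall>s\<in>{t-e<..<t}. p s = a" "\<forall>s\<in>{t<..<t+e}. p s = b"
        "adj_or_eq \<mu> a b" "p t = a \<or> p t = b"
      unfolding real_path_def by meson
    have "adj_or_eq \<mu> (p s) (p t)" if s: "s \<in> {0..1}" "\<bar>s - t\<bar> < e" for s
    proof (cases s t rule: linorder_cases)
      case less
      then have "p s = a" using e(2) s by auto
      then show ?thesis using e(4,5) by auto
    next
      case greater
      then have "p s = b" using e(3) s by auto
      \<comment> \<open>If \<open>p t\<close> is the left value \<open>a\<close>, the adjacency of
        \<open>a\<close> and \<open>b\<close> is needed in reverse.\<close>
      then show ?thesis using e(4,5) adj_or_eq_sym[OF sym] inY[OF s(1)] inY[OF t] by auto
    qed simp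
    then show ?thesis using e(1) by blast
  qed
qed

lemma real_homotopy_loop_rel:
  assumes sym: "symp_on Y \<mu>" and F: "pointed_real_homotopy X \<kappa> x0 Y \<mu> y0 f g F"
    and a: "a \<in> ec_loops X \<kappa> x0"
  shows "(f \<circ> a, g \<circ> a) \<in> loop_rel Y \<mu> y0"
proof -
  \<comment> \<open>The image of \<open>a\<close> at time \<open>t\<close>; it is a loop at
    \<open>y0\<close> because the homotopy fixes the base point.\<close>
  define L where "L t = (\<lambda>x. F x t) \<circ> a" for t
  have loop: "L t \<in> ec_loops Y \<mu> y0" if "t \<in> {0..1}" for t
    unfolding L_def using F that a
    by (intro ec_loops_comp) (auto simp: pointed_real_homotopy_def real_homotopy_def)
  obtain N where N: "\<forall>n\<ge>N. a n = x0" using a by (auto simp: ec_loops_dig_cont_iff)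
  have local: "\<exists>d>0. \<forall>s\<in>{0..1}. \<bar>s - t\<bar> < d \<longrightarrow> (L s, L t) \<in> loop_rel Y \<mu> y0"
    if t: "t \<in> {0..1}" for t
  proof -
    have "\<forall>n. \<exists>d>0. \<forall>s\<in>{0..1}. \<bar>s - t\<bar> < d \<longrightarrow> adj_or_eq \<mu> (F (a n) s) (F (a n) t)"
      using real_path_locally_adjacent[OF sym _ t] F ec_loops_in[OF a]
      by (simp add: pointed_real_homotopy_def real_homotopy_def)
    then obtain d where d: "\<And>n. d n > (0::real)"
      "\<And>n s. \<lbrakk>s \<in> {0..1}; \<bar>s - t\<bar> < d n\<rbrakk> \<Longrightarrow> adj_or_eq \<mu> (F (a n) s) (F (a n) t)"
      by metis
    \<comment> \<open>The radii at \<open>0, ..., N\<close> suffice: beyond \<open>N\<close> the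
      loop \<open>a\<close> is constant, so \<open>n\<close> can be replaced by
      \<open>min n N\<close>.\<close>
    define e where "e = Min (d ` {..N})"
    have e: "e > 0" "\<And>n. n \<le> N \<Longrightarrow> e \<le> d n" using d(1) by (auto simp: e_def)
    have "(L s, L t) \<in> loop_step Y \<mu> y0" if s: "s \<in> {0..1}" "\<bar>s - t\<bar> < e" for s
    proof -
      have "adj_or_eq \<mu> (L s n) (L t n)" for n
      proof -
        have "a n = a (min n N)" using N by (auto simp: min_def)
        moreover have "\<bar>s - t\<bar> < d (min n N)" using e(2)[of "min n N"] s(2) by simp
        ultimately show ?thesis using d(2)[OF s(1)] by (simp add: L_def)
      qed
      then show ?thesis using loop s(1) t by (simp add: loop_step_def)
    qed
    then show ?thesis using e(1) loop_step_imp_loop_rel[OF sym] by blast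
  qed
  \<comment> \<open>The local condition of \<open>Bolzano\<close> also admits \<open>u\<close> and
    \<open>v\<close> outside the unit interval, where \<open>L\<close> need not be a loop; the guard
    makes \<open>P\<close> vacuous there.\<close>
  define P where "P u v \<longleftrightarrow> (0 \<le> u \<and> v \<le> 1 \<longrightarrow> (L u, L v) \<in> loop_rel Y \<mu> y0)" for u v
  have "P 0 1"
  \<comment> \<open>Compactness by bisection: a property of intervals that is additive and holds on
    all short intervals around each point holds on the whole interval.\<close>
  proof (rule Bolzano)
    fix u v w :: real
    assume "P u v" "P v w" "u \<le> v" "v \<le> w"
    then show "P u w" by (auto simp: P_def intro: loop_rel_trans[OF sym])
  next
    fix t :: real assume "0 \<le> t" "t \<le> 1"
    then obtain d where d: "d > 0" "\<forall>s\<in>{0..1}. \<bar>s - t\<bar> < d \<longrightarrow> (L s, L t) \<in> loop_rel Y \<mu> y0"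
      using local by fastforce
    have "P u v" if "u \<le> t \<and> t \<le> v \<and> v - u < d" for u v
      unfolding P_def
    proof
      assume "0 \<le> u \<and> v \<le> 1"
      then have "(L u, L t) \<in> loop_rel Y \<mu> y0" "(L v, L t) \<in> loop_rel Y \<mu> y0"
        using d(2) that by auto
      then show "(L u, L v) \<in> loop_rel Y \<mu> y0"
        using loop_rel_sym[OF sym] loop_rel_trans[OF sym] by metis
    qed
    then show "\<exists>d>0. \<forall>u v. u \<le> t \<and> t \<le> v \<and> v - u < d \<longrightarrow> P u v" using d(1) by blast
  qed simp
  moreover have "L 0 = f \<circ> a" "L 1 = g \<circ> a"
    using F ec_loops_in[OF a] by (auto simp: L_def pointed_real_homotopy_def real_homotopy_def)
  ultimately show ?thesis by (simp add: P_def)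
qed

text \<open>Covers one composite only; the other follows by exchanging the two images.\<close>

lemma induced_inverse:
  assumes symX: "symp_on X \<kappa>" and symY: "symp_on Y \<mu>"
    and f: "dig_cont X \<kappa> Y \<mu> f" "f x0 = y0" and g: "dig_cont Y \<mu> X \<kappa> g" "g y0 = x0"
    and F: "pointed_real_homotopy X \<kappa> x0 X \<kappa> x0 (g \<circ> f) id F"
    and A: "A \<in> carrier (fundamental_group X \<kappa> x0)"
  shows "induced X \<kappa> x0 g (induced Y \<mu> y0 f A) = A"
proof -
  obtain a where a: "a \<in> ec_loops X \<kappa> x0" "A = loop_rel X \<kappa> x0 `` {a}"
    using A by (auto simp: fundamental_group_def elim: quotientE)
  have "loop_rel X \<kappa> x0 `` {g \<circ> (f \<circ> a)} = loop_rel X \<kappa> x0 `` {a}"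
    using real_homotopy_loop_rel[OF symX F a(1)]
    by (intro equiv_class_eq[OF equiv_loop_rel[OF symX]]) (simp add: comp_assoc)
  then show ?thesis
    using a ec_loops_comp[OF f a(1)]
    by (simp add: induced_class[OF symX symY f] induced_class[OF symY symX g])
qed

theorem theorem7p2:
  fixes X :: "(int ^ 'n) set" and \<kappa> :: "int ^ 'n \<Rightarrow> int ^ 'n \<Rightarrow> bool"
    and Y :: "(int ^ 'm) set" and \<mu> :: "int ^ 'm \<Rightarrow> int ^ 'm \<Rightarrow> bool"
    and x0 :: "int ^ 'n" and y0 :: "int ^ 'm"
  assumes "digital_image X \<kappa>" and "digital_image Y \<mu>"
    and "x0 \<in> X" and "y0 \<in> Y"
    and "same_pointed_real_homotopy_type X \<kappa> x0 Y \<mu> y0"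
  shows "fundamental_group X \<kappa> x0 \<cong> fundamental_group Y \<mu> y0"
proof -
  have symX: "symp_on X \<kappa>" and symY: "symp_on Y \<mu>"
    using assms(1,2) by (auto simp: digital_image_def)
  obtain f g F G where f: "dig_cont X \<kappa> Y \<mu> f" "f x0 = y0"
    and g: "dig_cont Y \<mu> X \<kappa> g" "g y0 = x0"
    and F: "pointed_real_homotopy X \<kappa> x0 X \<kappa> x0 (g \<circ> f) id F"
    and G: "pointed_real_homotopy Y \<mu> y0 Y \<mu> y0 (f \<circ> g) id G"
    using assms(5) by (auto simp: same_pointed_real_homotopy_type_def)
  note hf = induced_hom[OF symX symY f] and hg = induced_hom[OF symY symX g]
  \<comment> \<open>The map induced by \<open>g\<close> is the two-sided inverse; the homomorphism
    property of both maps also supplies that they land in the right carriers.\<close>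
  have "bij_betw (induced Y \<mu> y0 f)
      (carrier (fundamental_group X \<kappa> x0)) (carrier (fundamental_group Y \<mu> y0))"
    using hf hg induced_inverse[OF symX symY f g F] induced_inverse[OF symY symX g f G]
    by (intro bij_betw_byWitness[where f' = "induced X \<kappa> x0 g"]) (auto simp: hom_def)
  then show ?thesis using hf by (auto simp: is_iso_def iso_def)
qed

end
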